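(* If $\gamma$ is a closure operator on a frame $L$, then for every $y\in L$ $$\mathrm{nuc}_{\gamma(L)}(y)=\bigwedge_{x\in\gamma(L)}x^\natural(y)=\bigwedge_{u\in L}\gamma(u)^\natural(y).$$
   Context: A frame is a complete lattice in which $x\wedge\bigvee Y=\bigvee_{y\in Y}(x\wedge y)$ for every element $x$ and every subset $Y$. For $a,b$ in a frame $L$, $a\Rightarrow b$ denotes the relative pseudo-complement: the unique element with $x\wedge a\le b\iff x\le(a\Rightarrow b)$ for all $x\in L$. A closure operator on $L$ is an increasing, ascending ($x\le\gamma(x)$), idempotent map $L\to L$; a nucleus is a closure operator preserving binary meets. A nuclear system in $L$ is the fixpoint set of a nucleus on $L$ (and it determines this nucleus). Any intersection of nuclear systems in $L$ is a nuclear system. For $X\subseteq L$, $\mathrm{nucsys}(X)$ is the least nuclear system in $L$ that includes $X$, and $\mathrm{nuc}_X$ is the nucleus on $L$ whose fixpoint set is $\mathrm{nucsys}(X)$. For $x\in L$, $x^\natural:=\mathrm{nuc}_{\{x\}}$; concretely, $x^\natural(y)=((y\Rightarrow x)\Rightarrow x)$ for $y\in L$. The nucleus $\mathrm{nuc}_{\gamma(L)}$ is called the nuclear core of $\gamma$. *)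

theory Defs
  imports Main
begin

text \<open>Frames satisfy only the finite-meet/arbitrary-join law; the class
  \<^class>\<open>complete_distrib_lattice\<close> of Main is the strictly stronger notion of a completely
  distributive lattice.\<close>

class frame = complete_lattice +
  assumes inf_Sup_frame: "inf x (Sup Y) = (SUP y\<in>Y. inf x y)"

definition closure_operator :: "('a::frame \<Rightarrow> 'a) \<Rightarrow> bool" where
  "closure_operator c \<longleftrightarrow> mono c \<and> (\<forall>x. x \<le> c x) \<and> (\<forall>x. c (c x) = c x)"

definition nucleus :: "('a::frame \<Rightarrow> 'a) \<Rightarrow> bool" where
  "nucleus n \<longleftrightarrow> closure_operator n \<and> (\<forall>x y. n (inf x y) = inf (n x) (n y))"

definition fixpoints :: "('a \<Rightarrow> 'a) \<Rightarrow> 'a set" where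
  "fixpoints f = {x. f x = x}"

definition nuclear_system :: "'a::frame set \<Rightarrow> bool" where
  "nuclear_system S \<longleftrightarrow> (\<exists>n. nucleus n \<and> S = fixpoints n)"

definition nucsys :: "'a::frame set \<Rightarrow> 'a set" where
  "nucsys X = (LEAST S. nuclear_system S \<and> X \<subseteq> S)"

definition nuc :: "'a::frame set \<Rightarrow> 'a \<Rightarrow> 'a" where
  "nuc X = (THE n. nucleus n \<and> fixpoints n = nucsys X)"

definition natural_nucleus :: "'a::frame \<Rightarrow> 'a \<Rightarrow> 'a" (\<open>(_\<^sup>\<natural>)\<close> [1000] 1000) where
  "x\<^sup>\<natural> = nuc {x}"

text \<open>The remaining facts show that the descriptions in \<^const>\<open>nucsys\<close> and \<^const>\<open>nuc\<close>
  denote: every subset has a least nuclear system including it, and a nuclear system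
  determines its nucleus.\<close>

definition rel_pseudo_compl :: "'a::frame \<Rightarrow> 'a \<Rightarrow> 'a" where
  "rel_pseudo_compl a b = Sup {x. inf x a \<le> b}"

lemma le_rel_pseudo_compl_iff: "x \<le> rel_pseudo_compl a b \<longleftrightarrow> inf x a \<le> b"
  for x :: "'a::frame"
proof
  assume "x \<le> rel_pseudo_compl a b"
  then have "inf x a \<le> inf a (rel_pseudo_compl a b)"
    by (meson inf.boundedI inf.cobounded2 inf.coboundedI1)
  also have "\<dots> = (SUP y\<in>{x. inf x a \<le> b}. inf a y)"
    unfolding rel_pseudo_compl_def by (rule inf_Sup_frame)
  also have "\<dots> \<le> b"
    by (rule SUP_least) (simp add: inf.commute)
  finally show "inf x a \<le> b" .
next
  assume "inf x a \<le> b"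
  then show "x \<le> rel_pseudo_compl a b"
    unfolding rel_pseudo_compl_def by (intro Sup_upper) simp
qed

lemma nuclear_system_iff:
  "nuclear_system S \<longleftrightarrow>
    (\<forall>A\<subseteq>S. Inf A \<in> S) \<and> (\<forall>a. \<forall>s\<in>S. rel_pseudo_compl a s \<in> S)"
  (is "_ \<longleftrightarrow> ?R") for S :: "'a::frame set"
proof
  assume "nuclear_system S"
  then obtain n where n: "mono n" "\<And>x. x \<le> n x" "\<And>x y. n (inf x y) = inf (n x) (n y)"
    and S: "S = {x. n x = x}"
    by (auto simp: nuclear_system_def nucleus_def closure_operator_def fixpoints_def)
  have "Inf A \<in> S" if "A \<subseteq> S" for A
  proof -
    have "n (Inf A) \<le> a" if "a \<in> A" for a
      using monoD[OF n(1) Inf_lower[OF that]] \<open>A \<subseteq> S\<close> that S by auto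
    then show ?thesis using n(2) S by (auto intro: antisym Inf_greatest)
  qed
  moreover have "rel_pseudo_compl a s \<in> S" if "s \<in> S" for a s
  proof -
    let ?r = "rel_pseudo_compl a s"
    have "inf (n ?r) a \<le> n (inf ?r a)"
      by (simp add: n inf.coboundedI2)
    also have "\<dots> \<le> n s"
      using n(1) le_rel_pseudo_compl_iff by (blast intro: monoD)
    finally have "n ?r \<le> ?r" using that S le_rel_pseudo_compl_iff by auto
    then show ?thesis using n(2) S by (auto intro: antisym)
  qed
  ultimately show ?R by blast
next
  assume R: ?R
  define n where "n x = Inf {s\<in>S. x \<le> s}" for x
  have nS: "n x \<in> S" for x using R unfolding n_def by auto
  have le: "x \<le> n x" for x unfolding n_def by (auto intro: Inf_greatest)
  have least: "n x \<le> s" if "s \<in> S" "x \<le> s" for x s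
    using that unfolding n_def by (auto intro: Inf_lower)
  have mono: "mono n" by (meson monoI le least nS order_trans)
  have fixp: "n s = s" if "s \<in> S" for s using that le least by (auto intro: antisym)
  have "inf (n x) (n y) \<le> n (inf x y)" for x y
  proof -
    let ?s = "n (inf x y)"
    have "n x \<le> rel_pseudo_compl y ?s"
      using R nS le by (intro least) (auto simp: le_rel_pseudo_compl_iff)
    then have "y \<le> rel_pseudo_compl (n x) ?s"
      by (simp add: le_rel_pseudo_compl_iff inf.commute)
    then have "n y \<le> rel_pseudo_compl (n x) ?s"
      using R nS by (intro least) auto
    then show ?thesis by (simp add: le_rel_pseudo_compl_iff inf.commute)
  qed
  then have "n (inf x y) = inf (n x) (n y)" for x y
    by (intro antisym) (auto intro: monoD[OF mono])
  then have "nucleus n"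
    using mono le fixp nS by (auto simp: nucleus_def closure_operator_def)
  moreover have "S = fixpoints n"
    using fixp nS by (auto simp: fixpoints_def) (metis nS)
  ultimately show "nuclear_system S" unfolding nuclear_system_def by blast
qed

lemma nuclear_system_Inter:
  fixes F :: "'a::frame set set"
  assumes "\<And>S. S \<in> F \<Longrightarrow> nuclear_system S"
  shows "nuclear_system (\<Inter>F)"
  using assms unfolding nuclear_system_iff by (simp add: le_Inf_iff)

lemma nucsys_eq_Inter: "nucsys X = \<Inter>{S. nuclear_system S \<and> X \<subseteq> S}"
  for X :: "'a::frame set"
  unfolding nucsys_def
  by (rule Least_equality) (auto intro: nuclear_system_Inter)

lemma nuclear_system_nucsys: "nuclear_system (nucsys X)"
  unfolding nucsys_eq_Inter by (rule nuclear_system_Inter) simp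

lemma nucleus_eqI:
  fixes m n :: "'a::frame \<Rightarrow> 'a"
  assumes "nucleus m" "nucleus n" "fixpoints m = fixpoints n"
  shows "m = n"
proof
  have *: "f x \<le> g x"
    if "nucleus f" "nucleus g" "fixpoints f = fixpoints g" for f g :: "'a \<Rightarrow> 'a" and x
  proof -
    have "g x \<in> fixpoints g"
      using that(2) by (simp add: nucleus_def closure_operator_def fixpoints_def)
    then have "f (g x) = g x" using that(3) by (auto simp: fixpoints_def)
    moreover have "f x \<le> f (g x)"
      using that(1,2) by (simp add: nucleus_def closure_operator_def monoD)
    ultimately show ?thesis by simp
  qed
  show "m x = n x" for x using *[of m n] *[of n m] assms by (auto intro: antisym)
qed

lemma nuc_unique_existence: "\<exists>!n. nucleus n \<and> fixpoints n = nucsys X"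
  for X :: "'a::frame set"
  using nuclear_system_nucsys[of X] nucleus_eqI unfolding nuclear_system_def by metis

end

theory Submission
  imports Defs
begin

text \<open>For an arbitrary subset \<open>X\<close> of the frame, \<open>nuc X\<close> is the pointwise meet of the nuclei
  \<open>x\<^sup>\<natural>\<close>, \<open>x \<in> X\<close>. Passing to a larger generating set makes the nucleus smaller, which gives one
  inequality. For the other, the pointwise meet of the \<open>x\<^sup>\<natural>\<close> is again a nucleus and fixes every
  element of \<open>X\<close>, so its fixpoint set includes \<open>nucsys X\<close>.\<close>

lemma nucleus_mono: "nucleus n \<Longrightarrow> x \<le> y \<Longrightarrow> n x \<le> n y"
  by (simp add: nucleus_def closure_operator_def monoD)

lemma nucleus_ascending: "nucleus n \<Longrightarrow> x \<le> n x"
  by (simp add: nucleus_def closure_operator_def)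

lemma nucleus_idem: "nucleus n \<Longrightarrow> n (n x) = n x"
  by (simp add: nucleus_def closure_operator_def)

lemma nucleus_inf: "nucleus n \<Longrightarrow> n (inf x y) = inf (n x) (n y)"
  by (simp add: nucleus_def)

text \<open>The order on nuclei reverses inclusion of fixpoint sets: \<open>n y\<close> lies above
  \<open>y\<close> and, by idempotence of \<open>n\<close>, is fixed by \<open>n\<close> and hence
  by \<open>m\<close>.\<close>

lemma nucleus_le_of_fixpoints_subset:
  assumes "nucleus m" "nucleus n" "fixpoints n \<subseteq> fixpoints m"
  shows "m y \<le> n y"
proof -
  have "m y \<le> m (n y)"
    by (rule nucleus_mono[OF assms(1) nucleus_ascending[OF assms(2)]])
  also have "m (n y) = n y"
    using assms nucleus_idem by (fastforce simp: fixpoints_def)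
  finally show ?thesis .
qed

lemma nucleus_INF:
  assumes "\<And>i. i \<in> I \<Longrightarrow> nucleus (n i)"
  shows "nucleus (\<lambda>y. INF i\<in>I. n i y)"
proof -
  let ?m = "\<lambda>y. INF i\<in>I. n i y"
  have mono: "mono ?m"
    by (rule monoI, rule INF_superset_mono[OF order_refl]) (rule nucleus_mono[OF assms])
  have asc: "y \<le> ?m y" for y
    by (rule INF_greatest) (rule nucleus_ascending[OF assms])
  have "?m (?m y) \<le> ?m y" for y
  proof (rule INF_greatest)
    fix i assume i: "i \<in> I"
    have "?m (?m y) \<le> n i (?m y)"
      using i by (rule INF_lower)
    \<comment> \<open>Bounding the inner meet by its component at the same index \<open>i\<close>
      reduces idempotence of the meet to that of \<open>n i\<close> alone.\<close>
    also have "\<dots> \<le> n i (n i y)"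
      by (rule nucleus_mono[OF assms[OF i] INF_lower[OF i]])
    finally show "?m (?m y) \<le> n i y"
      by (simp add: nucleus_idem assms i)
  qed
  then have "?m (?m y) = ?m y" for y
    by (rule antisym[OF _ asc])
  moreover have "?m (inf x y) = inf (?m x) (?m y)" for x y
    by (simp add: INF_inf_distrib[symmetric] nucleus_inf assms)
  ultimately show ?thesis
    using mono asc by (simp add: nucleus_def closure_operator_def)
qed

lemma nucleus_nuc: "nucleus (nuc X)"
  and fixpoints_nuc: "fixpoints (nuc X) = nucsys X"
  using theI'[OF nuc_unique_existence[of X]] by (simp_all add: nuc_def)

lemma subset_nucsys: "X \<subseteq> nucsys X"
  unfolding nucsys_eq_Inter by blast

lemma nucsys_least: "nuclear_system S \<Longrightarrow> X \<subseteq> S \<Longrightarrow> nucsys X \<subseteq> S"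
  unfolding nucsys_eq_Inter by blast

lemma nuc_antimono:
  assumes "X \<subseteq> Y"
  shows "nuc Y z \<le> nuc X z"
proof (rule nucleus_le_of_fixpoints_subset[OF nucleus_nuc nucleus_nuc])
  show "fixpoints (nuc X) \<subseteq> fixpoints (nuc Y)"
    unfolding fixpoints_nuc
    using assms subset_nucsys by (intro nucsys_least nuclear_system_nucsys) blast
qed

lemma nuc_fixes: "x \<in> X \<Longrightarrow> nuc X x = x"
  using subset_nucsys[of X] fixpoints_nuc[of X] by (auto simp: fixpoints_def)

text \<open>Maximality of \<open>nuc X\<close> among the nuclei that fix \<open>X\<close> pointwise:
  \<open>fixpoints m\<close> is a nuclear system including \<open>X\<close>, so it includes
  \<open>nucsys X\<close>.\<close>

lemma le_nuc:
  assumes "nucleus m" "X \<subseteq> fixpoints m"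
  shows "m y \<le> nuc X y"
proof (rule nucleus_le_of_fixpoints_subset[OF assms(1) nucleus_nuc])
  show "fixpoints (nuc X) \<subseteq> fixpoints m"
    unfolding fixpoints_nuc
    using assms by (intro nucsys_least) (auto simp: nuclear_system_def)
qed

lemma nuc_eq_INF: "nuc X y = (INF x\<in>X. x\<^sup>\<natural> y)"
proof (rule antisym)
  show "nuc X y \<le> (INF x\<in>X. x\<^sup>\<natural> y)"
    unfolding natural_nucleus_def by (intro INF_greatest nuc_antimono) simp
  let ?m = "\<lambda>y. INF x\<in>X. x\<^sup>\<natural> y"
  have m: "nucleus ?m"
    by (rule nucleus_INF) (simp add: natural_nucleus_def nucleus_nuc)
  have "?m x = x" if "x \<in> X" for x
  proof (rule antisym)
    \<comment> \<open>The component indexed by \<open>x\<close> itself already fixes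
      \<open>x\<close>, which bounds the whole meet.\<close>
    have "?m x \<le> x\<^sup>\<natural> x"
      using that by (rule INF_lower)
    then show "?m x \<le> x"
      by (simp add: natural_nucleus_def nuc_fixes)
    show "x \<le> ?m x"
      by (rule nucleus_ascending[OF m])
  qed
  then show "?m y \<le> nuc X y"
    by (intro le_nuc[OF m]) (auto simp: fixpoints_def)
qed

theorem corollary6p8:
  fixes \<gamma> :: "'a::frame \<Rightarrow> 'a" and y :: 'a
  assumes "closure_operator \<gamma>"
  shows "nuc (range \<gamma>) y = (INF x\<in>range \<gamma>. x\<^sup>\<natural> y) \<and>
    (INF x\<in>range \<gamma>. x\<^sup>\<natural> y) = (INF u. (\<gamma> u)\<^sup>\<natural> y)"
  \<comment> \<open>The first equation is the case \<open>X = range \<gamma>\<close>;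
    \<open>image_image\<close> reindexes the meet over the range by \<open>u\<close>.\<close>
  by (simp add: nuc_eq_INF image_image)

end
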